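(* Let $\mathcal X,\mathcal S,\mathit\Theta$ be measurable spaces with $\mathcal X$ standard. Let $\boldsymbol\mu$ be a $\sigma$-finite measure on $\mathcal X$ and $S:\mathcal X\to\mathcal S$ a measurable map. Let $\mathbf P(X|\Theta):\mathit\Theta\dashrightarrow\mathcal X$ be a statistical model (Markov kernel) with $\mathbf P(X|\Theta=\theta)\ll\boldsymbol\mu$ for every $\theta\in\mathit\Theta$. Then the following two statements are equivalent: 1. $\mathbf P(X|\Theta)$ has a Radon–Nikodym derivative $p_\theta$ with respect to $\boldsymbol\mu$ of the form $$p_\theta(x)=h(x)\cdot g_\theta(S(x)),$$ with measurable maps $h:\mathcal X\to\mathbb R_{\ge0}$ and $g_\theta:\mathcal S\to\mathbb R_{\ge0}$ for $\theta\in\mathit\Theta$. (Joint measurability in $\theta$ is not assumed.) 2. $S$ is a sufficient statistic for $\mathbf P(X|\Theta)$, i.e. $X\perp\!\!\!\perp_{\mathbf P(X|\Theta)}\Theta\mid S$.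
   Context: A Markov kernel $\mathbf P(X|\Theta):\mathit\Theta\dashrightarrow\mathcal X$ assigns to each $\theta\in\mathit\Theta$ a probability measure $\mathbf P(X|\Theta=\theta)$ on $\mathcal X$ such that $\theta\mapsto\mathbf P(X\in A|\Theta=\theta)$ is measurable for every measurable $A$. A measurable space is standard if it is measurably isomorphic to a Borel subset of $[0,1]$. On the product space $\mathcal X\times\mathit\Theta$ let $X,\Theta$ be the coordinate projections, and $S=S(X)$. For each $\theta$ let $\mathbf P(X,\Theta,S|\Theta=\theta)$ be the law of $(x,\theta,S(x))$ for $x\sim\mathbf P(X|\Theta=\theta)$. The transitional conditional independence $X\perp\!\!\!\perp_{\mathbf P(X|\Theta)}\Theta\mid S$ means: there exists a Markov kernel $\mathbf Q(X|S):\mathcal S\dashrightarrow\mathcal X$ (not depending on $\theta$) such that $\mathbf P(X,\Theta,S|\Theta)=\mathbf Q(X|S)\otimes\mathbf P(\Theta,S|\Theta)$, i.e. for every $\theta$ and measurable $A\subseteq\mathcal X$, $D\subseteq\mathit\Theta$, $C\subseteq\mathcal S$: $\mathbf P(X\in A,\Theta\in D,S\in C|\Theta=\theta)=\int\mathbf 1_D(\theta')\mathbf 1_C(s)\,\mathbf Q(X\in A|S=s)\,\mathbf P((\Theta,S)\in d(\theta',s)|\Theta=\theta)$. *)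

theory Defs
  imports "HOL-Probability.Probability"
begin

text \<open>The underlying measurable space of a \<open>'a measure\<close> is what represents a measurable space;
  its measure part is ignored.\<close>

definition standard_measurable_space :: "'a measure \<Rightarrow> bool" where
  "standard_measurable_space M \<longleftrightarrow>
     (\<exists>(B :: real set) f g. B \<in> sets borel \<and> B \<subseteq> {0..1} \<and>
        f \<in> M \<rightarrow>\<^sub>M restrict_space borel B \<and> g \<in> restrict_space borel B \<rightarrow>\<^sub>M M \<and>
        (\<forall>x\<in>space M. g (f x) = x) \<and> (\<forall>y\<in>B. f (g y) = y))"

definition markov_kernel :: "'a measure \<Rightarrow> 'b measure \<Rightarrow> ('a \<Rightarrow> 'b measure) \<Rightarrow> bool" where
  "markov_kernel M N K \<longleftrightarrow> K \<in> M \<rightarrow>\<^sub>M prob_algebra N"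

lemma markov_kernel_iff:
  "markov_kernel M N K \<longleftrightarrow>
     (\<forall>x\<in>space M. prob_space (K x) \<and> sets (K x) = sets N) \<and>
     (\<forall>A\<in>sets N. (\<lambda>x. emeasure (K x) A) \<in> borel_measurable M)"
proof
  assume "markov_kernel M N K"
  then have K: "K \<in> M \<rightarrow>\<^sub>M prob_algebra N" by (simp add: markov_kernel_def)
  have "prob_space (K x) \<and> sets (K x) = sets N" if "x \<in> space M" for x
    using measurable_space[OF K that] by (simp add: space_prob_algebra)
  moreover have "(\<lambda>x. emeasure (K x) A) \<in> borel_measurable M" if "A \<in> sets N" for A
    using measurable_emeasure_kernel[OF measurable_prob_algebraD[OF K] that] .
  ultimately show "(\<forall>x\<in>space M. prob_space (K x) \<and> sets (K x) = sets N) \<and>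
     (\<forall>A\<in>sets N. (\<lambda>x. emeasure (K x) A) \<in> borel_measurable M)" by blast
next
  assume *: "(\<forall>x\<in>space M. prob_space (K x) \<and> sets (K x) = sets N) \<and>
     (\<forall>A\<in>sets N. (\<lambda>x. emeasure (K x) A) \<in> borel_measurable M)"
  then have "K \<in> M \<rightarrow>\<^sub>M subprob_algebra N"
    by (intro measurable_subprob_algebra) (auto intro: prob_space_imp_subprob_space)
  with * show "markov_kernel M N K"
    unfolding markov_kernel_def by (auto intro!: measurable_prob_algebraI)
qed

text \<open>\<open>law_XTS\<close> is \<open>P(X, \<Theta>, S | \<Theta> = \<theta>)\<close> and \<open>law_TS\<close> is its marginal \<open>P(\<Theta>, S | \<Theta> = \<theta>)\<close>.\<close>

definition law_XTS ::
  "'x measure \<Rightarrow> 't measure \<Rightarrow> 's measure \<Rightarrow> ('t \<Rightarrow> 'x measure) \<Rightarrow> ('x \<Rightarrow> 's) \<Rightarrow> 't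
    \<Rightarrow> ('x \<times> 't \<times> 's) measure" where
  "law_XTS \<X> \<Theta> \<S> P S \<theta> = distr (P \<theta>) (\<X> \<Otimes>\<^sub>M (\<Theta> \<Otimes>\<^sub>M \<S>)) (\<lambda>x. (x, \<theta>, S x))"

definition law_TS ::
  "'x measure \<Rightarrow> 't measure \<Rightarrow> 's measure \<Rightarrow> ('t \<Rightarrow> 'x measure) \<Rightarrow> ('x \<Rightarrow> 's) \<Rightarrow> 't
    \<Rightarrow> ('t \<times> 's) measure" where
  "law_TS \<X> \<Theta> \<S> P S \<theta> = distr (law_XTS \<X> \<Theta> \<S> P S \<theta>) (\<Theta> \<Otimes>\<^sub>M \<S>) snd"

text \<open>Transitional conditional independence of \<open>X\<close> and \<open>\<Theta>\<close> given \<open>S\<close>: the identity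
  \<open>P(X, \<Theta>, S | \<Theta>) = Q(X | S) \<otimes> P(\<Theta>, S | \<Theta>)\<close>, evaluated on measurable rectangles, with \<open>Q\<close>
  not depending on \<open>\<theta>\<close>.\<close>

definition trans_cond_indep ::
  "'x measure \<Rightarrow> 't measure \<Rightarrow> 's measure \<Rightarrow> ('t \<Rightarrow> 'x measure) \<Rightarrow> ('x \<Rightarrow> 's) \<Rightarrow> bool" where
  "trans_cond_indep \<X> \<Theta> \<S> P S \<longleftrightarrow>
     (\<exists>Q. markov_kernel \<S> \<X> Q \<and>
       (\<forall>\<theta>\<in>space \<Theta>. \<forall>A\<in>sets \<X>. \<forall>D\<in>sets \<Theta>. \<forall>C\<in>sets \<S>.
          emeasure (law_XTS \<X> \<Theta> \<S> P S \<theta>) (A \<times> D \<times> C) =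
          (\<integral>\<^sup>+ (\<theta>', s). indicator D \<theta>' * indicator C s * emeasure (Q s) A
             \<partial>law_TS \<X> \<Theta> \<S> P S \<theta>)))"

definition sufficient_statistic ::
  "'x measure \<Rightarrow> 't measure \<Rightarrow> 's measure \<Rightarrow> ('t \<Rightarrow> 'x measure) \<Rightarrow> ('x \<Rightarrow> 's) \<Rightarrow> bool" where
  "sufficient_statistic \<X> \<Theta> \<S> P S \<longleftrightarrow> trans_cond_indep \<X> \<Theta> \<S> P S"

end

theory Submission
  imports Defs
begin

text \<open>The bridge between the two statements is a single probability measure \<open>M \<lless> \<mu>\<close> for which every
  \<open>P \<theta>\<close> has a density of the form \<open>k\<^sub>\<theta> \<circ> S\<close>.

  Such an \<open>M\<close> gives the factorization at once: \<open>h = dM/d\<mu>\<close> and \<open>g\<^sub>\<theta> = k\<^sub>\<theta>\<close>. It also gives sufficiency: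
  since \<open>\<X>\<close> is standard, there is a regular conditional distribution \<open>Q\<close> of \<open>X\<close> given \<open>S\<close> under \<open>M\<close>,
  and reweighting \<open>M\<close> by a function of \<open>S\<close> alone changes the law of \<open>S\<close> but not the conditional law
  of \<open>X\<close> given \<open>S\<close>; so the same \<open>Q\<close> serves every \<open>\<theta>\<close>.

  For the two converse implications, \<open>M\<close> is a countable mixture of members of the model. By the
  Halmos--Savage exhaustion argument, countably many members already have all the null sets that are
  common to the whole model, so a mixture of these with positive weights dominates every
  \<open>P \<theta>\<close>. Both hypotheses pass to mixtures. If \<open>p\<^sub>\<theta> = h \<cdot> (g\<^sub>\<theta> \<circ> S)\<close>, then \<open>M\<close> has density
  \<open>h \<cdot> (G \<circ> S)\<close> with the same factor \<open>h\<close>, which cancels in \<open>dP\<^sub>\<theta>/dM = (g\<^sub>\<theta> / G) \<circ> S\<close>. If instead \<open>Q\<close> is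
  a conditional distribution given \<open>S\<close> for every \<open>P \<theta>\<close>, then it is one for \<open>M\<close>, and two measures with a
  common conditional distribution differ only through their laws of \<open>S\<close>, so that \<open>dP\<^sub>\<theta>/dM\<close> is the
  Radon--Nikodym derivative of these laws, evaluated at \<open>S\<close>.\<close>

section \<open>Regular conditional distributions\<close>

definition is_conditional_distribution ::
  "'x measure \<Rightarrow> 's measure \<Rightarrow> ('x \<Rightarrow> 's) \<Rightarrow> 'x measure \<Rightarrow> ('s \<Rightarrow> 'x measure) \<Rightarrow> bool" where
  "is_conditional_distribution \<X> \<S> S M Q \<longleftrightarrow>
     (\<forall>A\<in>sets \<X>. \<forall>C\<in>sets \<S>.
        emeasure M (A \<inter> S -` C) = (\<integral>\<^sup>+ s\<in>C. emeasure (Q s) A \<partial>distr M \<S> S))"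

text \<open>The measure \<open>C \<mapsto> M (E \<inter> {S \<in> C})\<close> lies below the law of \<open>S\<close>, hence has a Radon--Nikodym derivative
  with values in \<open>[0,1]\<close> almost everywhere. Truncating it at \<open>1\<close> makes the bounds hold everywhere, so that
  no exceptional null set has to be carried along in the construction of a kernel below.\<close>

lemma conditional_probability_exists:
  assumes "prob_space M" and S [measurable]: "S \<in> M \<rightarrow>\<^sub>M \<S>" and E [measurable]: "E \<in> sets M"
  obtains c :: "'s \<Rightarrow> real" where "c \<in> borel_measurable \<S>" "\<And>s. 0 \<le> c s" "\<And>s. c s \<le> 1"
    "\<And>C. C \<in> sets \<S> \<Longrightarrow> (LINT s:C|distr M \<S> S. c s) = measure M (E \<inter> S -` C \<inter> space M)"
proof -
  interpret prob_space M by fact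
  define \<nu> where "\<nu> = distr M \<S> S"
  interpret \<nu>: prob_space \<nu>
    unfolding \<nu>_def by (rule prob_space_distr) measurable
  define N where "N = distr (density M (indicator E)) \<S> S"
  have sets_\<nu> [measurable_cong, simp]: "sets \<nu> = sets \<S>" and sets_N [simp]: "sets N = sets \<S>"
    by (simp_all add: \<nu>_def N_def)
  have N: "emeasure N C = emeasure M (E \<inter> S -` C \<inter> space M)" if [measurable]: "C \<in> sets \<S>" for C
    by (simp add: N_def emeasure_distr emeasure_density nn_integral_set_ennreal[symmetric]
        flip: indicator_inter_arith)
       (simp add: Int_assoc)
  have \<nu>: "emeasure \<nu> C = emeasure M (S -` C \<inter> space M)" if [measurable]: "C \<in> sets \<S>" for C
    by (simp add: \<nu>_def emeasure_distr)
  have N_le: "emeasure N C \<le> emeasure \<nu> C" if [measurable]: "C \<in> sets \<S>" for C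
    unfolding N[OF that] \<nu>[OF that] by (intro emeasure_mono) auto
  have ac: "absolutely_continuous \<nu> N"
  proof -
    have "emeasure N C = 0" if "C \<in> sets \<S>" "emeasure \<nu> C = 0" for C
      using N_le[OF that(1)] that(2) by simp
    then show ?thesis
      by (auto simp: absolutely_continuous_def null_sets_def)
  qed
  have "finite_measure N"
    by (rule finite_measureI) (use N_le[of "space \<S>"] \<nu>.emeasure_finite in \<open>auto simp: top_unique N_def\<close>)
  obtain D where D [measurable]: "D \<in> borel_measurable \<nu>" and D_eq: "AE s in \<nu>. RN_deriv \<nu> N s = ennreal (D s)"
    and D_nn: "\<And>s. 0 \<le> D s"
    using \<nu>.real_RN_deriv[OF \<open>finite_measure N\<close> ac] by auto
  have N_D: "N = density \<nu> (\<lambda>s. ennreal (D s))"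
    using \<nu>.density_RN_deriv[OF ac] density_cong[OF _ _ D_eq] by simp
  have D_C: "emeasure N C = (\<integral>\<^sup>+ s. ennreal (indicator C s * D s) \<partial>\<nu>)" if [measurable]: "C \<in> sets \<S>" for C
    unfolding N_D by (subst emeasure_density) (auto intro!: nn_integral_cong simp: indicator_def)
  have "(\<integral>\<^sup>+ s. ennreal (D s) \<partial>\<nu>) = emeasure N (space \<nu>)"
    unfolding N_D using sets.top[of \<nu>]
    by (subst emeasure_density) (auto intro!: nn_integral_cong)
  also have "\<dots> < \<infinity>"
    using finite_measure.emeasure_finite[OF \<open>finite_measure N\<close>] by (simp add: less_top)
  finally have "(\<integral>\<^sup>+ s. ennreal (D s) \<partial>\<nu>) < \<infinity>" .
  then have int_D: "integrable \<nu> D"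
    by (intro integrableI_bounded) (auto simp: D_nn)
  have D_meas: "(LINT s:C|\<nu>. D s) = measure M (E \<inter> S -` C \<inter> space M)" if [measurable]: "C \<in> sets \<S>" for C
    using D_C[OF that] N[OF that] unfolding set_lebesgue_integral_def real_scaleR_def
    by (subst integral_eq_nn_integral) (auto simp: D_nn measure_def)
  have "AE s in \<nu>. 0 \<le> 1 - D s"
  proof (rule \<nu>.density_nonneg)
    fix A assume "A \<in> sets \<nu>"
    then have A [measurable]: "A \<in> sets \<S>" by simp
    have "measure M (E \<inter> S -` A \<inter> space M) \<le> measure M (S -` A \<inter> space M)"
      by (intro finite_measure_mono) auto
    also have "\<dots> = measure \<nu> A" by (simp add: \<nu>_def measure_distr)
    also have "\<dots> = (LINT s:A|\<nu>. 1)"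
      by (simp add: set_lebesgue_integral_def)
    finally have "(LINT s:A|\<nu>. D s) \<le> (LINT s:A|\<nu>. 1)"
      by (simp add: D_meas[OF A])
    moreover have "set_integrable \<nu> A (\<lambda>_. 1 :: real)" "set_integrable \<nu> A D"
      unfolding set_integrable_def by (intro integrable_mult_indicator; use int_D in simp)+
    ultimately show "0 \<le> (LINT s:A|\<nu>. 1 - D s)"
      by (simp add: set_integral_diff)
  qed (use int_D in auto)
  then have c: "AE s in \<nu>. min 1 (D s) = D s" by eventually_elim auto
  show thesis
  proof (rule that[of "\<lambda>s. min 1 (D s)"])
    show "(\<lambda>s. min 1 (D s)) \<in> borel_measurable \<S>" by measurable
    fix C assume [measurable]: "C \<in> sets \<S>"
    show "(LINT s:C|distr M \<S> S. min 1 (D s)) = measure M (E \<inter> S -` C \<inter> space M)"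
      unfolding D_meas[OF \<open>C \<in> _\<close>, symmetric] \<nu>_def[symmetric]
      by (rule set_lebesgue_integral_cong_AE) (use c in auto)
  qed (auto simp: D_nn)
qed

text \<open>The kernel is given by conditional distribution functions. Versions of the conditional
  probabilities of \<open>{Z \<le> q}\<close> are monotone in \<open>q\<close> only up to null sets that depend on the pair of
  arguments. Instead of discarding such null sets, the versions at rationals are turned into a distribution
  function \<^emph>\<open>everywhere\<close> by setting \<open>F s x = inf {G q s | q \<in> \<rat>, q > x}\<close>: an infimum over rationals beyond
  \<open>x\<close> is increasing and right continuous whatever the values \<open>G q s \<in> [0,1]\<close> are, and the limits at \<open>\<plusminus>\<infinity>\<close> are
  right because \<open>Z\<close> has values in \<open>[0,1]\<close>, which allows \<open>G q = 0\<close> for \<open>q < 0\<close> and \<open>G q = 1\<close> for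
  \<open>q \<ge> 1\<close>. Almost everywhere monotonicity of \<open>G\<close> then shows that \<open>F\<close> still has the
  correct integrals.\<close>

lemma regular_conditional_distribution_unit_interval:
  fixes Z :: "'x \<Rightarrow> real"
  assumes "prob_space M" and S [measurable]: "S \<in> M \<rightarrow>\<^sub>M \<S>" and Z [measurable]: "Z \<in> borel_measurable M"
    and Z01: "\<And>x. x \<in> space M \<Longrightarrow> 0 \<le> Z x \<and> Z x \<le> 1"
  obtains K where "K \<in> \<S> \<rightarrow>\<^sub>M prob_algebra borel"
    "\<And>B C. B \<in> sets borel \<Longrightarrow> C \<in> sets \<S> \<Longrightarrow>
       emeasure M (Z -` B \<inter> S -` C \<inter> space M) = (\<integral>\<^sup>+ s\<in>C. emeasure (K s) B \<partial>distr M \<S> S)"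
proof -
  interpret prob_space M by fact
  define \<nu> where "\<nu> = distr M \<S> S"
  interpret \<nu>: prob_space \<nu>
    unfolding \<nu>_def by (rule prob_space_distr) measurable
  have sets_\<nu> [measurable_cong, simp]: "sets \<nu> = sets \<S>"
    by (simp_all add: \<nu>_def)
  \<comment> \<open>the joint law of \<open>Z\<close> and \<open>S\<close>, as a measure in \<open>Z\<close> for each event \<open>S \<in> C\<close>\<close>
  define N where "N C = distr (density M (indicator (S -` C \<inter> space M))) borel Z" for C
  have N: "emeasure (N C) B = emeasure M (Z -` B \<inter> S -` C \<inter> space M)"
    if [measurable]: "C \<in> sets \<S>" "B \<in> sets borel" for B C
    by (simp add: N_def emeasure_distr emeasure_density flip: indicator_inter_arith)
       (simp add: Int_ac)
  have fin_N: "finite_borel_measure (N C)" if "C \<in> sets \<S>" for C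
    using N[OF that, of UNIV]
    by (auto simp: finite_borel_measure_def finite_borel_measure_axioms_def N_def intro!: finite_measureI)
  have cdf_N: "cdf (N C) x = measure M (Z -` {..x} \<inter> S -` C \<inter> space M)" if "C \<in> sets \<S>" for C x
    using N[OF that, of "{..x}"] by (simp add: cdf_def measure_def)

  have "\<exists>c. c \<in> borel_measurable \<S> \<and> (\<forall>s. 0 \<le> c s \<and> c s \<le> 1) \<and>
      (\<forall>C\<in>sets \<S>. (LINT s:C|\<nu>. c s) = cdf (N C) q)" for q
  proof -
    obtain c where "c \<in> borel_measurable \<S>" "\<And>s. 0 \<le> c s" "\<And>s. c s \<le> 1"
      "\<And>C. C \<in> sets \<S> \<Longrightarrow> (LINT s:C|\<nu>. c s) = measure M (Z -` {..q} \<inter> space M \<inter> S -` C \<inter> space M)"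
      unfolding \<nu>_def
      by (rule conditional_probability_exists[OF \<open>prob_space M\<close> S, of "Z -` {..q} \<inter> space M"]) auto
    then show ?thesis
      by (intro exI[of _ c]) (auto simp: cdf_N Int_ac)
  qed
  then obtain c where c: "\<And>q. c q \<in> borel_measurable \<S>" "\<And>q s. 0 \<le> c q s" "\<And>q s. c q s \<le> 1"
      "\<And>q C. C \<in> sets \<S> \<Longrightarrow> (LINT s:C|\<nu>. c q s) = cdf (N C) q"
    by metis
  define G where "G q s = (if q < 0 then 0 else if 1 \<le> q then 1 else c q s)" for q s
  have G [measurable]: "G q \<in> borel_measurable \<S>" for q
    unfolding G_def using c(1) by measurable
  have G01: "0 \<le> G q s" "G q s \<le> 1" for q s
    using c by (auto simp: G_def)
  have int_bounded: "set_integrable \<nu> C f"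
    if "f \<in> borel_measurable \<S>" "\<And>s. 0 \<le> f s" "\<And>s. f s \<le> 1" "C \<in> sets \<S>" for f :: "_ \<Rightarrow> real" and C
    unfolding set_integrable_def
    by (rule \<nu>.integrable_const_bound[where B=1]) (use that in \<open>auto simp: indicator_def\<close>)
  have G_int: "(LINT s:C|\<nu>. G q s) = cdf (N C) q" if C [measurable]: "C \<in> sets \<S>" for q C
  proof -
    consider "q < 0" | "1 \<le> q" | "0 \<le> q" "q < 1" by linarith
    then show ?thesis
    proof cases
      case 1
      then have "Z -` {..q} \<inter> S -` C \<inter> space M = {}" using Z01 by fastforce
      with 1 show ?thesis by (simp add: G_def cdf_N)
    next
      case 2
      then have "Z -` {..q} \<inter> S -` C \<inter> space M = S -` C \<inter> space M" using Z01 by fastforce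
      with 2 show ?thesis
        by (simp add: G_def cdf_N \<nu>_def measure_distr set_lebesgue_integral_def)
    next
      case 3
      then show ?thesis using c(4)[OF C] by (simp add: G_def)
    qed
  qed
  have G_mono: "AE s in \<nu>. G x s \<le> G q s" if "x \<le> q" for x q
  proof -
    have "AE s in \<nu>. 0 \<le> G q s - G x s"
    proof (rule \<nu>.density_nonneg)
      show "integrable \<nu> (\<lambda>s. G q s - G x s)"
        by (intro Bochner_Integration.integrable_diff \<nu>.integrable_const_bound[where B=1]) (use G01 in auto)
      fix C assume "C \<in> sets \<nu>"
      then have C: "C \<in> sets \<S>" by simp
      have "(LINT s:C|\<nu>. G q s - G x s) = cdf (N C) q - cdf (N C) x"
        by (subst set_integral_diff) (use C G G01 G_int[OF C] in \<open>auto intro!: int_bounded\<close>)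
      then show "0 \<le> (LINT s:C|\<nu>. G q s - G x s)"
        using finite_borel_measure.cdf_nondecreasing[OF fin_N[OF C] that] by simp
    qed
    then show ?thesis by eventually_elim auto
  qed
  define R where "R x = {q\<in>\<rat>. x < (q::real)}" for x
  have R: "R x \<noteq> {}" "countable (R x)" for x
    using Rats_dense_in_real[of x "x+1"]
    by (auto simp: R_def intro!: countable_subset[OF _ countable_rat])
  define F where "F s x = (INF q\<in>R x. G q s)" for s x
  have bdd: "bdd_below ((\<lambda>q. G q s) ` A)" for s A
    using G01 by (auto intro!: bdd_belowI[of _ 0])
  have F_le: "F s x \<le> G q s" if "x < q" "q \<in> \<rat>" for s x q
    unfolding F_def by (rule cINF_lower[OF bdd]) (use that in \<open>auto simp: R_def\<close>)
  have F01: "0 \<le> F s x" "F s x \<le> 1" for s x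
  proof -
    show "0 \<le> F s x" unfolding F_def using R by (intro cINF_greatest) (auto simp: G01)
    obtain q where "q \<in> \<rat>" "x < q" using Rats_dense_in_real[of x "x+1"] by auto
    from F_le[OF this(2,1), of s] G01(2)[of q s] show "F s x \<le> 1" by simp
  qed
  have F [measurable]: "(\<lambda>s. F s x) \<in> borel_measurable \<S>" for x
    unfolding F_def by (intro borel_measurable_cINF_real R G)
  have F_mono: "F s x \<le> F s y" if "x \<le> y" for s x y
    unfolding F_def by (rule cINF_superset_mono) (use that R bdd in \<open>auto simp: R_def\<close>)
  have F_cont: "continuous (at_right a) (F s)" for s a
  proof (subst continuous_at_right_real_increasing)
    show "\<forall>e>0. \<exists>d>0. F s (a + d) - F s a < e"
    proof (intro allI impI)
      fix e :: real assume "0 < e"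
      then have "F s a < F s a + e" by simp
      then obtain q where q: "q \<in> R a" "G q s < F s a + e"
        unfolding F_def cINF_less_iff[OF R(1) bdd] by auto
      have "F s (a + (q - a) / 2) \<le> G q s"
        by (rule F_le) (use q in \<open>auto simp: R_def field_simps\<close>)
      then show "\<exists>d>0. F s (a + d) - F s a < e"
        using q by (intro exI[of _ "(q - a) / 2"]) (auto simp: R_def)
    qed
  qed (rule F_mono)
  have F_neg: "F s x = 0" if "x < 0" for s x
  proof -
    obtain q where "q \<in> \<rat>" "x < q" "q < 0" using Rats_dense_in_real[OF \<open>x < 0\<close>] by auto
    then show ?thesis using F_le[of x q s] F01[of s x] by (simp add: G_def)
  qed
  have F_ge1: "F s x = 1" if "1 \<le> x" for s x
    using that R(1)[of x] by (auto simp: F_def R_def G_def cong: INF_cong_simp)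
  have F_bot: "(F s \<longlongrightarrow> 0) at_bot" for s
    by (rule tendsto_eventually)
       (auto simp: eventually_at_bot_linorder F_neg intro!: exI[of _ "-1"])
  have F_top: "(F s \<longlongrightarrow> 1) at_top" for s
    by (rule tendsto_eventually)
       (auto simp: eventually_at_top_linorder F_ge1 intro!: exI[of _ "1"])
  \<comment> \<open>\<open>G x \<le> F x \<le> G q\<close> for all rational \<open>q > x\<close>; let \<open>q\<close> decrease to \<open>x\<close>\<close>
  have F_int: "(LINT s:C|\<nu>. F s x) = cdf (N C) x" if C [measurable]: "C \<in> sets \<S>" for C x
  proof (rule antisym)
    have "AE s in \<nu>. \<forall>q\<in>R x. G x s \<le> G q s"
      using R G_mono by (subst AE_ball_countable) (auto simp: R_def)
    then have "AE s in \<nu>. G x s \<le> F s x"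
      by eventually_elim (auto simp: F_def R intro!: cINF_greatest)
    then have "(LINT s:C|\<nu>. G x s) \<le> (LINT s:C|\<nu>. F s x)"
      unfolding set_lebesgue_integral_def
      by (intro integral_mono_AE int_bounded[unfolded set_integrable_def])
         (auto simp: G01 F01 indicator_def)
    then show "cdf (N C) x \<le> (LINT s:C|\<nu>. F s x)" using G_int[OF C] by simp
    have le: "(LINT s:C|\<nu>. F s x) \<le> cdf (N C) q" if "q \<in> \<rat>" "x < q" for q
      unfolding G_int[OF C, symmetric] set_lebesgue_integral_def
      using F_le that
      by (intro integral_mono_AE int_bounded[unfolded set_integrable_def])
         (auto simp: G01 F01 indicator_def)
    show "(LINT s:C|\<nu>. F s x) \<le> cdf (N C) x"
    proof (rule field_le_epsilon)
      fix e :: real assume "0 < e"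
      have "(cdf (N C) \<longlongrightarrow> cdf (N C) x) (at_right x)"
        using finite_borel_measure.cdf_is_right_cont[OF fin_N[OF C], of x]
        by (simp add: continuous_within)
      then have "eventually (\<lambda>y. cdf (N C) y < cdf (N C) x + e) (at_right x)"
        by (rule order_tendstoD) (use \<open>0 < e\<close> in simp)
      then obtain b where b: "x < b" "\<And>y. x < y \<Longrightarrow> y < b \<Longrightarrow> cdf (N C) y < cdf (N C) x + e"
        by (auto simp: eventually_at_right[OF less_add_one])
      obtain q where "q \<in> \<rat>" "x < q" "q < b" using Rats_dense_in_real[OF b(1)] by auto
      with le[of q] b(2)[of q] show "(LINT s:C|\<nu>. F s x) \<le> cdf (N C) x + e" by simp
    qed
  qed
  define K where "K s = interval_measure (F s)" for s
  have K_Iic: "emeasure (K s) {..x} = ennreal (F s x)" for s x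
    unfolding K_def by (rule emeasure_interval_measure_Iic[OF F_mono F_cont F_bot])
  have prob_K: "prob_space (K s)" for s
    using real_distribution_interval_measure[OF F_mono F_cont F_bot F_top, of s]
    by (simp add: K_def real_distribution_def)
  have borel_Iic: "sets borel = sigma_sets UNIV (range (\<lambda>a::real. {..a}))"
    by (simp add: borel_eq_atMost)
  have Int_stable_Iic: "Int_stable (range (\<lambda>a::real. {..a}))"
    by (auto simp: Int_stable_def)
  have K [measurable]: "K \<in> \<S> \<rightarrow>\<^sub>M prob_algebra borel"
  proof (rule measurable_prob_algebra_generated[OF borel_Iic Int_stable_Iic])
    fix A :: "real set" assume "A \<in> range atMost"
    then show "(\<lambda>s. emeasure (K s) A) \<in> borel_measurable \<S>"
      by (auto simp: K_Iic)
  qed (use prob_K in \<open>auto simp: K_def\<close>)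
  have "space \<S> \<noteq> {}"
    using measurable_space[OF S] not_empty by blast
  show thesis
  proof (rule that[OF K])
    fix B :: "real set" and C assume B: "B \<in> sets borel" and C [measurable]: "C \<in> sets \<S>"
    define L where "L = density \<nu> (indicator C) \<bind> K"
    have [simp]: "sets L = sets borel"
      unfolding L_def by (rule sets_bind[where N=borel])
        (use \<open>space \<S> \<noteq> {}\<close> in \<open>auto simp: \<nu>_def K_def\<close>)
    have L: "emeasure L A = (\<integral>\<^sup>+ s\<in>C. emeasure (K s) A \<partial>\<nu>)" if [measurable]: "A \<in> sets borel" for A
    proof -
      have [measurable]: "(\<lambda>s. emeasure (K s) A) \<in> borel_measurable \<S>"
        by (rule measurable_emeasure_kernel[OF measurable_prob_algebraD[OF K] that])
      have "emeasure L A = (\<integral>\<^sup>+ s. emeasure (K s) A \<partial>density \<nu> (indicator C))"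
        unfolding L_def
      proof (rule emeasure_bind)
        show "K \<in> density \<nu> (indicator C) \<rightarrow>\<^sub>M subprob_algebra borel"
          using measurable_prob_algebraD[OF K] by (simp cong: measurable_cong_sets)
      qed (use \<open>space \<S> \<noteq> {}\<close> in \<open>auto simp: \<nu>_def\<close>)
      then show ?thesis
        by (simp add: nn_integral_density mult.commute)
    qed
    \<comment> \<open>both are finite measures on the line, so half-lines suffice\<close>
    have "N C = L"
    proof (rule measure_eqI_generator_eq[OF Int_stable_Iic, where A="\<lambda>i. {..real i}"])
      fix X :: "real set" assume "X \<in> range atMost"
      then obtain x where X: "X = {..x}" by auto
      have "emeasure L X = (\<integral>\<^sup>+ s. ennreal (indicator C s * F s x) \<partial>\<nu>)"
        by (simp add: L X K_Iic) (auto intro!: nn_integral_cong simp: indicator_def)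
      also have "\<dots> = ennreal (LINT s:C|\<nu>. F s x)"
        unfolding set_lebesgue_integral_def real_scaleR_def
        by (rule nn_integral_eq_integral)
           (use int_bounded[OF F F01 C] in \<open>auto simp: set_integrable_def F01\<close>)
      also have "\<dots> = emeasure (N C) X"
        using fin_N[OF C] unfolding F_int[OF C] X cdf_def
        by (simp add: finite_measure.emeasure_eq_measure finite_borel_measure_def)
      finally show "emeasure (N C) X = emeasure L X" ..
    next
      show "(\<Union>i. {..real i}) = UNIV"
        by (auto intro: real_arch_simple)
      show "sets (N C) = sigma_sets UNIV (range atMost)"
        using borel_Iic by (simp add: N_def)
      show "sets L = sigma_sets UNIV (range atMost)"
        using borel_Iic by simp
      show "emeasure (N C) {..real i} \<noteq> \<infinity>" for i
        using fin_N[OF C] by (simp add: finite_measure.emeasure_finite finite_borel_measure_def)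
    qed auto
    then show "emeasure M (Z -` B \<inter> S -` C \<inter> space M) = (\<integral>\<^sup>+ s\<in>C. emeasure (K s) B \<partial>distr M \<S> S)"
      using N[OF C B] L[OF B] by (simp add: \<nu>_def)
  qed
qed

text \<open>A standard space is a Borel subset of \<open>[0,1]\<close> up to isomorphism. The kernel for the embedded
  variable may charge the complement of that subset; since the inverse isomorphism is extended by
  a constant to the whole line, the push-forward is a probability measure on \<open>\<X>\<close> for every \<open>s\<close> all the
  same.\<close>

lemma regular_conditional_distribution_standard:
  assumes "standard_measurable_space \<X>" "prob_space M" and sets_M [measurable_cong, simp]: "sets M = sets \<X>"
    and S [measurable]: "S \<in> \<X> \<rightarrow>\<^sub>M \<S>"
  obtains Q where "Q \<in> \<S> \<rightarrow>\<^sub>M prob_algebra \<X>" "is_conditional_distribution \<X> \<S> S M Q"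
proof -
  interpret prob_space M by fact
  have space_M: "space M = space \<X>" by (rule sets_eq_imp_space_eq) simp
  obtain x\<^sub>0 where x\<^sub>0: "x\<^sub>0 \<in> space \<X>" using not_empty by (auto simp: space_M)
  obtain B :: "real set" and f g where B: "B \<in> sets borel" "B \<subseteq> {0..1}"
    and f: "f \<in> \<X> \<rightarrow>\<^sub>M restrict_space borel B" and g: "g \<in> restrict_space borel B \<rightarrow>\<^sub>M \<X>"
    and gf: "\<And>x. x \<in> space \<X> \<Longrightarrow> g (f x) = x"
    using assms(1) unfolding standard_measurable_space_def by auto
  have f_B: "f x \<in> B" if "x \<in> space \<X>" for x
    using measurable_space[OF f that] by (simp add: space_restrict_space)
  have f_borel [measurable]: "f \<in> borel_measurable \<X>"
    using f B by (simp add: measurable_restrict_space2_iff)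
  define r where "r y = (if y \<in> B then g y else x\<^sub>0)" for y
  have r [measurable]: "r \<in> borel \<rightarrow>\<^sub>M \<X>"
    unfolding r_def using g B x\<^sub>0 by (subst measurable_If_restrict_space_iff) auto
  obtain K where K [measurable]: "K \<in> \<S> \<rightarrow>\<^sub>M prob_algebra borel"
    and K_eq: "\<And>B C. B \<in> sets borel \<Longrightarrow> C \<in> sets \<S> \<Longrightarrow>
       emeasure M (f -` B \<inter> S -` C \<inter> space M) = (\<integral>\<^sup>+ s\<in>C. emeasure (K s) B \<partial>distr M \<S> S)"
  proof (rule regular_conditional_distribution_unit_interval[of M S \<S> f])
    show "0 \<le> f x \<and> f x \<le> 1" if "x \<in> space M" for x
      using f_B[of x] that B(2) by (auto simp: space_M)
  qed (auto intro: \<open>prob_space M\<close>)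
  define Q where "Q s = distr (K s) \<X> r" for s
  show thesis
  proof (rule that)
    show "Q \<in> \<S> \<rightarrow>\<^sub>M prob_algebra \<X>"
      unfolding Q_def by measurable
    show "is_conditional_distribution \<X> \<S> S M Q"
      unfolding is_conditional_distribution_def
    proof (intro ballI)
      fix A C assume A [measurable]: "A \<in> sets \<X>" and C [measurable]: "C \<in> sets \<S>"
      have sub: "A \<subseteq> space \<X>" using sets.sets_into_space[OF A] .
      have rA: "r -` A \<in> sets borel" using measurable_sets[OF r A] by simp
      have "A \<inter> S -` C = f -` (r -` A) \<inter> S -` C \<inter> space M"
        using sub f_B gf by (auto simp: space_M r_def)
      then have "emeasure M (A \<inter> S -` C) = (\<integral>\<^sup>+ s\<in>C. emeasure (K s) (r -` A) \<partial>distr M \<S> S)"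
        using K_eq[OF rA C] by simp
      also have "\<dots> = (\<integral>\<^sup>+ s\<in>C. emeasure (Q s) A \<partial>distr M \<S> S)"
      proof (rule nn_integral_cong)
        fix s assume "s \<in> space (distr M \<S> S)"
        then have s: "s \<in> space \<S>" by simp
        then have [measurable_cong, simp]: "sets (K s) = sets borel"
          using measurable_space[OF K s] by (simp add: space_prob_algebra)
        then have "space (K s) = UNIV" by (simp add: sets_eq_imp_space_eq[OF \<open>sets (K s) = _\<close>])
        then show "emeasure (K s) (r -` A) * indicator C s = emeasure (Q s) A * indicator C s"
          unfolding Q_def by (subst emeasure_distr) auto
      qed
      finally show "emeasure M (A \<inter> S -` C) = (\<integral>\<^sup>+ s\<in>C. emeasure (Q s) A \<partial>distr M \<S> S)" .
    qed
  qed
qed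

section \<open>Countable domination\<close>

text \<open>The exhaustion argument of Halmos and Savage. Let \<open>E t\<close> be the set where the density of
  \<open>P t\<close> is non-zero, and let \<open>m\<close> be a finite measure equivalent to \<open>\<mu>\<close>. Among the countable index sets
  \<open>D\<close> one maximizes the \<open>m\<close>-measure of \<open>U = \<Union>t\<in>D. E t\<close>; the supremum is attained because a union of
  countably many countable sets is countable. Adding one more index cannot enlarge \<open>U\<close>, so every
  \<open>E t\<close> is contained in \<open>U\<close> up to a null set.\<close>

lemma countable_dominating_subfamily:
  assumes "sigma_finite_measure \<mu>"
    and sets_P: "\<And>t. t \<in> T \<Longrightarrow> sets (P t) = sets \<mu>"
    and ac: "\<And>t. t \<in> T \<Longrightarrow> absolutely_continuous \<mu> (P t)"
  obtains D where "countable D" "D \<subseteq> T"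
    "\<And>t A. t \<in> T \<Longrightarrow> (\<And>d. d \<in> D \<Longrightarrow> A \<in> null_sets (P d)) \<Longrightarrow> A \<in> sets \<mu> \<Longrightarrow> A \<in> null_sets (P t)"
proof -
  interpret \<mu>: sigma_finite_measure \<mu> by fact
  obtain h where h [measurable]: "h \<in> borel_measurable \<mu>" and h_fin: "integral\<^sup>N \<mu> h \<noteq> \<infinity>"
    and h_pos: "\<And>x. x \<in> space \<mu> \<Longrightarrow> 0 < h x"
    using \<mu>.Ex_finite_integrable_function by auto
  define m where "m = density \<mu> h"
  have [measurable_cong, simp]: "sets m = sets \<mu>" by (simp add: m_def)
  interpret m: finite_measure m
    by (rule finite_measureI) (use h_fin in \<open>auto simp: m_def emeasure_density nn_integral_set_ennreal cong: nn_integral_cong\<close>)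
  have null_m: "A \<in> null_sets m \<longleftrightarrow> A \<in> null_sets \<mu>" if [measurable]: "A \<in> sets \<mu>" for A
  proof -
    have "A \<in> null_sets m \<longleftrightarrow> (AE x in \<mu>. x \<in> A \<longrightarrow> h x = 0)"
      unfolding m_def by (subst null_sets_density_iff) auto
    also have "\<dots> \<longleftrightarrow> (AE x in \<mu>. x \<notin> A)"
      by (rule AE_cong) (use h_pos in \<open>auto dest!: h_pos\<close>)
    finally show ?thesis by (simp add: AE_iff_null_sets)
  qed
  define p where "p t = RN_deriv \<mu> (P t)" for t
  have p [measurable]: "p t \<in> borel_measurable \<mu>" for t
    by (simp add: p_def)
  have P_p: "P t = density \<mu> (p t)" if "t \<in> T" for t
    unfolding p_def using \<mu>.density_RN_deriv[OF ac sets_P] that by simp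
  define E where "E t = {x\<in>space \<mu>. p t x \<noteq> 0}" for t
  have E [measurable]: "E t \<in> sets \<mu>" for t unfolding E_def by measurable
  have null_P: "A \<in> null_sets (P t) \<longleftrightarrow> A \<inter> E t \<in> null_sets \<mu>" if "t \<in> T" and [measurable]: "A \<in> sets \<mu>" for A t
  proof -
    have "A \<in> null_sets (P t) \<longleftrightarrow> (AE x in \<mu>. x \<in> A \<longrightarrow> p t x = 0)"
      unfolding P_p[OF \<open>t \<in> T\<close>] by (subst null_sets_density_iff) auto
    also have "\<dots> \<longleftrightarrow> (AE x in \<mu>. x \<notin> A \<inter> E t)"
      by (rule AE_cong) (auto simp: E_def)
    finally show ?thesis by (simp add: AE_iff_null_sets)
  qed
  define \<D> where "\<D> = {D. countable D \<and> D \<subseteq> T}"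
  define v where "v D = emeasure m (\<Union>t\<in>D. E t)" for D
  have v_mono: "v D \<le> v D'" if "D \<subseteq> D'" "D' \<in> \<D>" for D D'
    unfolding v_def using that by (intro emeasure_mono sets.countable_UN'') (auto simp: \<D>_def)
  have "\<D> \<noteq> {}" by (auto simp: \<D>_def)
  from ennreal_SUP_countable_SUP[OF this, of v]
  obtain y :: "nat \<Rightarrow> ennreal" where y: "range y \<subseteq> v ` \<D>" "(SUP D\<in>\<D>. v D) = (SUP n. y n)"
    by auto
  then have "\<forall>n. \<exists>D. D \<in> \<D> \<and> y n = v D" by auto
  then obtain Dn where Dn: "\<And>n. Dn n \<in> \<D>" "\<And>n. y n = v (Dn n)" by metis
  define D where "D = (\<Union>n. Dn n)"
  have D: "D \<in> \<D>" using Dn by (auto simp: D_def \<D>_def)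
  have D_max: "v D' \<le> v D" if "D' \<in> \<D>" for D'
  proof -
    have "v D' \<le> (SUP n. y n)" unfolding y(2)[symmetric] by (rule SUP_upper[OF that])
    also have "\<dots> \<le> v D" unfolding Dn(2) using D by (intro SUP_least v_mono) (auto simp: D_def)
    finally show ?thesis .
  qed
  define U where "U = (\<Union>t\<in>D. E t)"
  have U [measurable]: "U \<in> sets \<mu>" unfolding U_def using D by (intro sets.countable_UN'') (auto simp: \<D>_def)
  have E_U: "E t - U \<in> null_sets \<mu>" if "t \<in> T" for t
  proof -
    have "v (insert t D) = emeasure m (U \<union> (E t - U))"
      unfolding v_def U_def by (rule arg_cong[where f="emeasure m"]) auto
    also have "\<dots> = emeasure m U + emeasure m (E t - U)"
      by (rule plus_emeasure[symmetric]) auto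
    finally have "emeasure m U + emeasure m (E t - U) \<le> emeasure m U"
      using D_max[of "insert t D"] D that by (auto simp: \<D>_def v_def U_def)
    then have "emeasure m (E t - U) = 0"
      using m.emeasure_finite[of U] ennreal_add_left_cancel_le[of "emeasure m U" _ 0] by simp
    then have "E t - U \<in> null_sets m" by auto
    then show ?thesis by (simp add: null_m)
  qed
  show thesis
  proof (rule that)
    show "countable D" "D \<subseteq> T" using D by (auto simp: \<D>_def)
    fix t A assume t: "t \<in> T" and A: "\<And>d. d \<in> D \<Longrightarrow> A \<in> null_sets (P d)" and [measurable]: "A \<in> sets \<mu>"
    have "(\<Union>d\<in>D. A \<inter> E d) \<in> null_sets \<mu>"
    proof (rule null_sets_UN')
      show "countable D" using D by (auto simp: \<D>_def)
      fix d assume "d \<in> D"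
      then show "A \<inter> E d \<in> null_sets \<mu>" using A[of d] null_P[of d A] D by (auto simp: \<D>_def)
    qed
    then have "(\<Union>d\<in>D. A \<inter> E d) \<union> (E t - U) \<in> null_sets \<mu>"
      using E_U[OF t] by (rule null_sets.Un)
    then have "A \<inter> E t \<in> null_sets \<mu>"
      by (rule null_sets_subset) (auto simp: U_def)
    then show "A \<in> null_sets (P t)" using null_P[OF t] by simp
  qed
qed

text \<open>The mixture is over a geometric distribution because that charges every natural number; a set is null
  for such a mixture iff it is null for all of its components.\<close>

lemma dominating_mixture:
  assumes \<mu>: "sigma_finite_measure \<mu>" and "T \<noteq> {}"
    and prob: "\<And>t. t \<in> T \<Longrightarrow> prob_space (P t)" and sets_P: "\<And>t. t \<in> T \<Longrightarrow> sets (P t) = sets \<mu>"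
    and ac: "\<And>t. t \<in> T \<Longrightarrow> absolutely_continuous \<mu> (P t)"
  obtains M and t :: "nat \<Rightarrow> 't" and w :: "nat \<Rightarrow> ennreal" where
    "prob_space M" "sets M = sets \<mu>" "absolutely_continuous \<mu> M" "\<And>n. t n \<in> T"
    "\<And>f. f \<in> borel_measurable \<mu> \<Longrightarrow> (\<integral>\<^sup>+ x. f x \<partial>M) = (\<Sum>n. w n * (\<integral>\<^sup>+ x. f x \<partial>P (t n)))"
    "\<And>\<theta>. \<theta> \<in> T \<Longrightarrow> absolutely_continuous M (P \<theta>)"
proof -
  obtain D where D: "countable D" "D \<subseteq> T" and
    D_dom: "\<And>t A. t \<in> T \<Longrightarrow> (\<And>d. d \<in> D \<Longrightarrow> A \<in> null_sets (P d)) \<Longrightarrow> A \<in> sets \<mu> \<Longrightarrow> A \<in> null_sets (P t)"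
    by (rule countable_dominating_subfamily[OF \<mu>, of T P])
       (use sets_P ac in auto)
  \<comment> \<open>one index is added to \<open>D\<close> because only a non-empty set can be enumerated by all natural numbers\<close>
  obtain t\<^sub>0 where "t\<^sub>0 \<in> T" using \<open>T \<noteq> {}\<close> by auto
  define t where "t = from_nat_into (insert t\<^sub>0 D)"
  have range_t: "range t = insert t\<^sub>0 D"
    unfolding t_def using D by (intro range_from_nat_into) auto
  then have t: "t n \<in> T" for n using D \<open>t\<^sub>0 \<in> T\<close> rangeI[of t n] by auto
  define p :: "nat pmf" where "p = geometric_pmf (1/2)"
  define M where "M = measure_pmf p \<bind> (\<lambda>n. P (t n))"
  have K: "(\<lambda>n. P (t n)) \<in> measure_pmf p \<rightarrow>\<^sub>M prob_algebra \<mu>"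
    using t prob sets_P by (simp add: space_prob_algebra)
  have sets_M: "sets M = sets \<mu>"
    unfolding M_def by (rule sets_bind) (use t sets_P in auto)
  have nn_M: "(\<integral>\<^sup>+ x. f x \<partial>M) = (\<Sum>n. ennreal (pmf p n) * (\<integral>\<^sup>+ x. f x \<partial>P (t n)))"
    if [measurable]: "f \<in> borel_measurable \<mu>" for f
    unfolding M_def by (subst nn_integral_bind[OF that measurable_prob_algebraD[OF K]])
      (simp add: nn_integral_measure_pmf nn_integral_count_space_nat)
  have M: "emeasure M A = (\<Sum>n. ennreal (pmf p n) * emeasure (P (t n)) A)" if "A \<in> sets \<mu>" for A
    using nn_M[of "indicator A"] that by (simp add: sets_M sets_P t)
  show thesis
  proof (rule that[OF _ sets_M _ t nn_M])
    show "prob_space M"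
      unfolding M_def
      by (rule measure_pmf.prob_space_bind[OF _ measurable_prob_algebraD[OF K]])
         (use prob t in auto)
    show "absolutely_continuous \<mu> M"
      unfolding absolutely_continuous_def
    proof
      fix A assume A: "A \<in> null_sets \<mu>"
      then have "emeasure (P (t n)) A = 0" for n
        using ac[OF t] by (auto simp: absolutely_continuous_def)
      with A show "A \<in> null_sets M"
        by (simp add: null_sets_def sets_M M)
    qed
    fix \<theta> assume "\<theta> \<in> T"
    show "absolutely_continuous M (P \<theta>)"
      unfolding absolutely_continuous_def
    proof
      fix A assume "A \<in> null_sets M"
      then have A: "A \<in> sets \<mu>" and "emeasure M A = 0" by (auto simp: null_sets_def sets_M)
      then have "ennreal (pmf p n) * emeasure (P (t n)) A = 0" for n
        by (simp add: M suminf_eq_zero_iff)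
      then have null: "emeasure (P (t n)) A = 0" for n
        by (simp add: p_def)
      show "A \<in> null_sets (P \<theta>)"
      proof (rule D_dom[OF \<open>\<theta> \<in> T\<close> _ A])
        fix d assume "d \<in> D"
        then obtain n where "d = t n" using range_t by (metis imageE insertI2)
        then show "A \<in> null_sets (P d)" using null A t by (auto simp: null_sets_def sets_P)
      qed
    qed
  qed
qed

section \<open>Densities that are functions of the statistic\<close>

text \<open>The defining identity, read for fixed \<open>A\<close> as an equality of measures in \<open>C\<close>, extends from
  indicators of \<open>C\<close> to all nonnegative functions of \<open>S\<close>.\<close>

lemma is_conditional_distribution_nn_integral:
  assumes sets_M [measurable_cong, simp]: "sets M = sets \<X>"
    and S [measurable]: "S \<in> \<X> \<rightarrow>\<^sub>M \<S>" and Q [measurable]: "Q \<in> \<S> \<rightarrow>\<^sub>M prob_algebra \<X>"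
    and cond: "is_conditional_distribution \<X> \<S> S M Q"
    and A [measurable]: "A \<in> sets \<X>" and f [measurable]: "f \<in> borel_measurable \<S>"
  shows "(\<integral>\<^sup>+ x\<in>A. f (S x) \<partial>M) = (\<integral>\<^sup>+ s. f s * emeasure (Q s) A \<partial>distr M \<S> S)"
proof -
  have [measurable]: "(\<lambda>s. emeasure (Q s) A) \<in> borel_measurable \<S>"
    by (rule measurable_emeasure_kernel[OF measurable_prob_algebraD[OF Q] A])
  have space_M: "space M = space \<X>" by (rule sets_eq_imp_space_eq) simp
  have eq: "distr (density M (indicator A)) \<S> S = density (distr M \<S> S) (\<lambda>s. emeasure (Q s) A)"
  proof (rule measure_eqI)
    fix C assume "C \<in> sets (distr (density M (indicator A)) \<S> S)"
    then have C [measurable]: "C \<in> sets \<S>" by simp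
    have "A \<inter> (S -` C \<inter> space \<X>) = A \<inter> S -` C"
      using sets.sets_into_space[OF A] by auto
    moreover have "A \<inter> (S -` C \<inter> space \<X>) \<in> sets \<X>" by measurable
    ultimately have "emeasure (distr (density M (indicator A)) \<S> S) C = emeasure M (A \<inter> S -` C)"
      by (simp add: emeasure_distr emeasure_density space_M
          flip: indicator_inter_arith)
    also have "\<dots> = emeasure (density (distr M \<S> S) (\<lambda>s. emeasure (Q s) A)) C"
      using cond A C by (simp add: is_conditional_distribution_def emeasure_density)
    finally show "emeasure (distr (density M (indicator A)) \<S> S) C =
        emeasure (density (distr M \<S> S) (\<lambda>s. emeasure (Q s) A)) C" .
  qed simp
  have "(\<integral>\<^sup>+ x\<in>A. f (S x) \<partial>M) = (\<integral>\<^sup>+ s. f s \<partial>distr (density M (indicator A)) \<S> S)"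
    by (simp add: nn_integral_distr nn_integral_density mult.commute)
  also have "\<dots> = (\<integral>\<^sup>+ s. f s * emeasure (Q s) A \<partial>distr M \<S> S)"
    unfolding eq by (simp add: nn_integral_density mult.commute)
  finally show ?thesis .
qed

text \<open>A weight that depends on \<open>x\<close> only through \<open>S x\<close> factors out of the integral over each fibre of \<open>S\<close>, so
  it rescales both sides of the defining identity in the same way.\<close>

lemma is_conditional_distribution_density:
  assumes sets_M [measurable_cong, simp]: "sets M = sets \<X>"
    and S [measurable]: "S \<in> \<X> \<rightarrow>\<^sub>M \<S>" and Q [measurable]: "Q \<in> \<S> \<rightarrow>\<^sub>M prob_algebra \<X>"
    and cond: "is_conditional_distribution \<X> \<S> S M Q"
    and k [measurable]: "k \<in> borel_measurable \<S>"
  shows "is_conditional_distribution \<X> \<S> S (density M (\<lambda>x. k (S x))) Q"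
  unfolding is_conditional_distribution_def
proof (intro ballI)
  fix A C assume A [measurable]: "A \<in> sets \<X>" and C [measurable]: "C \<in> sets \<S>"
  have [measurable]: "(\<lambda>s. emeasure (Q s) A) \<in> borel_measurable \<S>"
    by (rule measurable_emeasure_kernel[OF measurable_prob_algebraD[OF Q] A])
  have AC: "A \<inter> S -` C = A \<inter> (S -` C \<inter> space \<X>)"
    using sets.sets_into_space[OF A] by auto
  have "A \<inter> S -` C \<in> sets M" unfolding AC by simp
  then have "emeasure (density M (\<lambda>x. k (S x))) (A \<inter> S -` C) =
      (\<integral>\<^sup>+ x. k (S x) * indicator (A \<inter> S -` C) x \<partial>M)"
    by (intro emeasure_density) auto
  also have "\<dots> = (\<integral>\<^sup>+ x\<in>A. (k (S x) * indicator C (S x)) \<partial>M)"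
    by (rule nn_integral_cong) (auto simp: indicator_def)
  also have "\<dots> = (\<integral>\<^sup>+ s. (k s * indicator C s) * emeasure (Q s) A \<partial>distr M \<S> S)"
    by (rule is_conditional_distribution_nn_integral[OF sets_M S Q cond A]) measurable
  also have "\<dots> = (\<integral>\<^sup>+ s\<in>C. emeasure (Q s) A \<partial>distr (density M (\<lambda>x. k (S x))) \<S> S)"
    by (simp add: nn_integral_distr nn_integral_density mult_ac)
  finally show "emeasure (density M (\<lambda>x. k (S x))) (A \<inter> S -` C) =
      (\<integral>\<^sup>+ s\<in>C. emeasure (Q s) A \<partial>distr (density M (\<lambda>x. k (S x))) \<S> S)" .
qed

text \<open>Both measures are recovered from their laws of \<open>S\<close> by the same kernel, so a density between these
  laws lifts to a density between the measures.\<close>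

lemma density_if_common_conditional_distribution:
  assumes M: "prob_space M" and sets_M [measurable_cong, simp]: "sets M = sets \<X>"
    and sets_N [measurable_cong, simp]: "sets N = sets \<X>"
    and S [measurable]: "S \<in> \<X> \<rightarrow>\<^sub>M \<S>" and Q [measurable]: "Q \<in> \<S> \<rightarrow>\<^sub>M prob_algebra \<X>"
    and cond_M: "is_conditional_distribution \<X> \<S> S M Q"
    and cond_N: "is_conditional_distribution \<X> \<S> S N Q"
    and ac: "absolutely_continuous M N"
  shows "N = density M (\<lambda>x. RN_deriv (distr M \<S> S) (distr N \<S> S) (S x))"
proof (rule measure_eqI)
  interpret \<nu>: prob_space "distr M \<S> S"
    by (rule prob_space.prob_space_distr[OF M]) simp
  have space_M: "space M = space \<X>" and space_N: "space N = space \<X>"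
    by (rule sets_eq_imp_space_eq, simp)+
  have ac': "absolutely_continuous (distr M \<S> S) (distr N \<S> S)"
    using ac by (auto simp: absolutely_continuous_def null_sets_distr_iff space_M space_N)
  define k where "k = RN_deriv (distr M \<S> S) (distr N \<S> S)"
  have [measurable]: "k \<in> borel_measurable \<S>"
    using borel_measurable_RN_deriv[of "distr M \<S> S" "distr N \<S> S"] by (simp add: k_def)
  have k: "density (distr M \<S> S) k = distr N \<S> S"
    unfolding k_def by (rule \<nu>.density_RN_deriv[OF ac']) simp
  fix A assume "A \<in> sets N"
  then have A [measurable]: "A \<in> sets \<X>" by simp
  have [measurable]: "(\<lambda>s. emeasure (Q s) A) \<in> borel_measurable \<S>"
    by (rule measurable_emeasure_kernel[OF measurable_prob_algebraD[OF Q] A])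
  have "emeasure N A = emeasure N (A \<inter> S -` space \<S>)"
    using sets.sets_into_space[OF A] measurable_space[OF S] by (intro arg_cong[where f="emeasure N"]) auto
  also have "\<dots> = (\<integral>\<^sup>+ s\<in>space \<S>. emeasure (Q s) A \<partial>distr N \<S> S)"
    using cond_N A by (auto simp: is_conditional_distribution_def)
  also have "\<dots> = (\<integral>\<^sup>+ s. emeasure (Q s) A \<partial>distr N \<S> S)"
    by (rule nn_integral_cong) auto
  also have "\<dots> = (\<integral>\<^sup>+ s. k s * emeasure (Q s) A \<partial>distr M \<S> S)"
    unfolding k[symmetric] by (rule nn_integral_density) auto
  also have "\<dots> = (\<integral>\<^sup>+ x\<in>A. k (S x) \<partial>M)"
    by (rule is_conditional_distribution_nn_integral[OF sets_M S Q cond_M A, symmetric]) measurable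
  also have "\<dots> = emeasure (density M (\<lambda>x. k (S x))) A"
    by (rule emeasure_density[symmetric]) auto
  finally show "emeasure N A = emeasure (density M (\<lambda>x. RN_deriv (distr M \<S> S) (distr N \<S> S) (S x))) A"
    by (simp add: k_def)
qed simp

text \<open>Under \<open>P \<theta>\<close> the parameter component is the constant \<open>\<theta>\<close>, so both sides of the identity on the rectangle
  \<open>A \<times> D \<times> C\<close> carry the factor \<open>indicator D \<theta>\<close>, and only the choice \<open>D = space \<Theta>\<close> matters.\<close>

lemma sufficient_statistic_iff_conditional_distribution:
  assumes S [measurable]: "S \<in> \<X> \<rightarrow>\<^sub>M \<S>" and P: "markov_kernel \<Theta> \<X> P"
  shows "sufficient_statistic \<X> \<Theta> \<S> P S \<longleftrightarrow>
    (\<exists>Q. Q \<in> \<S> \<rightarrow>\<^sub>M prob_algebra \<X> \<and>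
      (\<forall>\<theta>\<in>space \<Theta>. is_conditional_distribution \<X> \<S> S (P \<theta>) Q))"
proof -
  have "(\<forall>A\<in>sets \<X>. \<forall>D\<in>sets \<Theta>. \<forall>C\<in>sets \<S>.
          emeasure (law_XTS \<X> \<Theta> \<S> P S \<theta>) (A \<times> D \<times> C) =
          (\<integral>\<^sup>+ (\<theta>', s). indicator D \<theta>' * indicator C s * emeasure (Q s) A
             \<partial>law_TS \<X> \<Theta> \<S> P S \<theta>)) \<longleftrightarrow> is_conditional_distribution \<X> \<S> S (P \<theta>) Q"
    (is "?L \<longleftrightarrow> ?R")
    if \<theta> [simp]: "\<theta> \<in> space \<Theta>" and Q [measurable]: "Q \<in> \<S> \<rightarrow>\<^sub>M prob_algebra \<X>" for \<theta> Q
  proof -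
    have [measurable_cong, simp]: "sets (P \<theta>) = sets \<X>"
      using P by (simp add: markov_kernel_iff)
    then have space_P: "space (P \<theta>) = space \<X>" by (rule sets_eq_imp_space_eq)
    have law: "emeasure (law_XTS \<X> \<Theta> \<S> P S \<theta>) (A \<times> D \<times> C) = indicator D \<theta> * emeasure (P \<theta>) (A \<inter> S -` C)"
      if [measurable]: "A \<in> sets \<X>" "D \<in> sets \<Theta>" "C \<in> sets \<S>" for A D C
    proof -
      have "(\<lambda>x. (x, \<theta>, S x)) -` (A \<times> D \<times> C) \<inter> space (P \<theta>) = (if \<theta> \<in> D then A \<inter> S -` C else {})"
        using sets.sets_into_space[OF that(1)] by (auto simp: space_P)
      then show ?thesis
        unfolding law_XTS_def by (subst emeasure_distr) (auto simp: indicator_def)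
    qed
    have int: "(\<integral>\<^sup>+ (\<theta>', s). indicator D \<theta>' * indicator C s * emeasure (Q s) A \<partial>law_TS \<X> \<Theta> \<S> P S \<theta>) =
        indicator D \<theta> * (\<integral>\<^sup>+ s\<in>C. emeasure (Q s) A \<partial>distr (P \<theta>) \<S> S)"
      if A: "A \<in> sets \<X>" and [measurable]: "D \<in> sets \<Theta>" "C \<in> sets \<S>" for A D C
    proof -
      have [measurable]: "(\<lambda>s. emeasure (Q s) A) \<in> borel_measurable \<S>"
        by (rule measurable_emeasure_kernel[OF measurable_prob_algebraD[OF Q] A])
      have TS: "law_TS \<X> \<Theta> \<S> P S \<theta> = distr (P \<theta>) (\<Theta> \<Otimes>\<^sub>M \<S>) (\<lambda>x. (\<theta>, S x))"
        unfolding law_TS_def law_XTS_def by (subst distr_distr) (auto simp: comp_def)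
      show ?thesis
        unfolding TS
        by (subst nn_integral_distr)
           (auto simp: nn_integral_distr nn_integral_cmult[symmetric] mult_ac intro!: nn_integral_cong)
    qed
    show ?thesis
    proof
      assume L: ?L
      show ?R
        unfolding is_conditional_distribution_def
      proof (intro ballI)
        fix A C assume "A \<in> sets \<X>" "C \<in> sets \<S>"
        with L[rule_format, of A "space \<Theta>" C]
        show "emeasure (P \<theta>) (A \<inter> S -` C) = (\<integral>\<^sup>+ s\<in>C. emeasure (Q s) A \<partial>distr (P \<theta>) \<S> S)"
          by (simp add: law int)
      qed
    next
      assume ?R
      then show ?L by (auto simp: law int is_conditional_distribution_def)
    qed
  qed
  then show ?thesis
    unfolding sufficient_statistic_def trans_cond_indep_def markov_kernel_def by blast
qed

text \<open>From a factorization, the mixture \<open>M\<close> of the \<open>P (t n)\<close> with weights \<open>w n\<close> has density \<open>m = h \<cdot> (G \<circ> S)\<close>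
  with \<open>G = (\<Sum>n. w n * g (t n))\<close>, and the quotient of densities is \<open>g\<^sub>\<theta> / G\<close>. The series \<open>G\<close> takes
  extended real values, since nothing prevents it from diverging where \<open>h\<close> vanishes.\<close>

lemma factorization_iff_dominating_density:
  assumes \<mu>: "sigma_finite_measure \<mu>" and "T \<noteq> {}"
    and prob: "\<And>t. t \<in> T \<Longrightarrow> prob_space (P t)" and sets_P: "\<And>t. t \<in> T \<Longrightarrow> sets (P t) = sets \<mu>"
    and ac: "\<And>t. t \<in> T \<Longrightarrow> absolutely_continuous \<mu> (P t)"
    and S [measurable]: "S \<in> \<mu> \<rightarrow>\<^sub>M \<S>"
  shows "(\<exists>(h :: 'x \<Rightarrow> real) (g :: 't \<Rightarrow> 's \<Rightarrow> real).
            h \<in> borel_measurable \<mu> \<and> (\<forall>x\<in>space \<mu>. 0 \<le> h x) \<and>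
            (\<forall>\<theta>\<in>T. g \<theta> \<in> borel_measurable \<S> \<and> (\<forall>s\<in>space \<S>. 0 \<le> g \<theta> s) \<and>
               P \<theta> = density \<mu> (\<lambda>x. ennreal (h x * g \<theta> (S x)))))
         \<longleftrightarrow> (\<exists>M. prob_space M \<and> sets M = sets \<mu> \<and> absolutely_continuous \<mu> M \<and>
               (\<forall>\<theta>\<in>T. \<exists>k\<in>borel_measurable \<S>. P \<theta> = density M (\<lambda>x. k (S x))))"
    (is "?L \<longleftrightarrow> ?R")
proof
  assume ?L
  then obtain h and g :: "'t \<Rightarrow> 's \<Rightarrow> real" where h [measurable]: "h \<in> borel_measurable \<mu>"
    and h_nn: "\<And>x. x \<in> space \<mu> \<Longrightarrow> 0 \<le> h x"
    and g: "\<And>\<theta>. \<theta> \<in> T \<Longrightarrow> g \<theta> \<in> borel_measurable \<S>"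
    and g_nn: "\<And>\<theta> s. \<theta> \<in> T \<Longrightarrow> s \<in> space \<S> \<Longrightarrow> 0 \<le> g \<theta> s"
    and P: "\<And>\<theta>. \<theta> \<in> T \<Longrightarrow> P \<theta> = density \<mu> (\<lambda>x. ennreal (h x * g \<theta> (S x)))"
    by blast
  have S_space: "S x \<in> space \<S>" if "x \<in> space \<mu>" for x
    by (rule measurable_space[OF S that])
  obtain M and t :: "nat \<Rightarrow> 't" and w :: "nat \<Rightarrow> ennreal" where
    M: "prob_space M" and sets_M [measurable_cong, simp]: "sets M = sets \<mu>"
    and ac_M: "absolutely_continuous \<mu> M" and t: "\<And>n. t n \<in> T"
    and nn_M: "\<And>f. f \<in> borel_measurable \<mu> \<Longrightarrow> (\<integral>\<^sup>+ x. f x \<partial>M) = (\<Sum>n. w n * (\<integral>\<^sup>+ x. f x \<partial>P (t n)))"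
    and dom: "\<And>\<theta>. \<theta> \<in> T \<Longrightarrow> absolutely_continuous M (P \<theta>)"
    by (rule dominating_mixture[OF \<mu> \<open>T \<noteq> {}\<close> prob sets_P ac]) (assumption | rule that | blast)+
  define G where "G s = (\<Sum>n. w n * ennreal (g (t n) s))" for s
  have g_t [measurable]: "g (t n) \<in> borel_measurable \<S>" for n using g t by simp
  have G [measurable]: "G \<in> borel_measurable \<S>" unfolding G_def by measurable
  define m where "m x = ennreal (h x) * G (S x)" for x
  have m [measurable]: "m \<in> borel_measurable \<mu>" unfolding m_def by measurable
  have M_density: "M = density \<mu> m"
  proof (rule measure_eqI)
    fix A assume "A \<in> sets M"
    then have A [measurable]: "A \<in> sets \<mu>" by simp
    have "emeasure M A = (\<Sum>n. w n * emeasure (P (t n)) A)"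
      using nn_M[of "indicator A"] by (simp add: sets_P t)
    also have "\<dots> = (\<Sum>n. \<integral>\<^sup>+ x. w n * (ennreal (h x * g (t n) (S x)) * indicator A x) \<partial>\<mu>)"
      by (simp add: P[OF t] emeasure_density nn_integral_cmult)
    also have "\<dots> = (\<integral>\<^sup>+ x. (\<Sum>n. w n * (ennreal (h x * g (t n) (S x)) * indicator A x)) \<partial>\<mu>)"
      by (rule nn_integral_suminf[symmetric]) measurable
    also have "\<dots> = (\<integral>\<^sup>+ x\<in>A. m x \<partial>\<mu>)"
    proof (rule nn_integral_cong)
      fix x assume x: "x \<in> space \<mu>"
      have "w n * (ennreal (h x * g (t n) (S x)) * indicator A x) =
          (ennreal (h x) * indicator A x) * (w n * ennreal (g (t n) (S x)))" for n
        using h_nn[OF x] g_nn[OF t S_space[OF x]] by (simp add: ennreal_mult mult_ac)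
      then have "(\<Sum>n. w n * (ennreal (h x * g (t n) (S x)) * indicator A x)) =
          (ennreal (h x) * indicator A x) * G (S x)"
        by (simp only: ennreal_suminf_cmult G_def)
      then show "(\<Sum>n. w n * (ennreal (h x * g (t n) (S x)) * indicator A x)) = m x * indicator A x"
        by (simp add: m_def mult_ac)
    qed
    also have "\<dots> = emeasure (density \<mu> m) A"
      by (rule emeasure_density[symmetric]) auto
    finally show "emeasure M A = emeasure (density \<mu> m) A" .
  qed simp
  have "(\<integral>\<^sup>+ x. m x \<partial>\<mu>) \<noteq> \<infinity>"
    using prob_space.emeasure_space_1[OF M]
    by (simp add: M_density emeasure_density cong: nn_integral_cong)
  then have m_fin: "AE x in \<mu>. m x \<noteq> \<infinity>"
    by (intro nn_integral_PInf_AE) auto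
  have "\<exists>k\<in>borel_measurable \<S>. P \<theta> = density M (\<lambda>x. k (S x))" if \<theta>: "\<theta> \<in> T" for \<theta>
  proof
    have [measurable]: "g \<theta> \<in> borel_measurable \<S>" using g[OF \<theta>] .
    define k where "k s = ennreal (g \<theta> s) / G s" for s
    show [measurable]: "(\<lambda>s. ennreal (g \<theta> s) / G s) \<in> borel_measurable \<S>" by measurable
    \<comment> \<open>where \<open>m\<close> vanishes it cannot be cancelled; there domination makes the density of \<open>P \<theta>\<close> vanish too\<close>
    define Z where "Z = {x\<in>space \<mu>. m x = 0}"
    have Z [measurable]: "Z \<in> sets \<mu>" unfolding Z_def by measurable
    have "Z \<in> null_sets M"
      unfolding M_density by (subst null_sets_density_iff) (auto simp: Z_def)
    then have "Z \<in> null_sets (P \<theta>)" using dom[OF \<theta>] by (auto simp: absolutely_continuous_def)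
    then have "AE x in \<mu>. x \<in> Z \<longrightarrow> ennreal (h x * g \<theta> (S x)) = 0"
      unfolding P[OF \<theta>] by (subst (asm) null_sets_density_iff) auto
    then have "AE x in \<mu>. ennreal (h x * g \<theta> (S x)) = m x * k (S x)"
      using m_fin AE_space
    proof eventually_elim
      case (elim x)
      show ?case
      proof (cases "m x = 0")
        case True
        then show ?thesis using elim by (simp add: Z_def)
      next
        case False
        then have "0 < ennreal (h x)" "G (S x) \<noteq> 0" "G (S x) \<noteq> \<infinity>"
          using elim(2) by (auto simp: m_def ennreal_mult_eq_top_iff zero_less_iff_neq_zero)
        then have "G (S x) * k (S x) = ennreal (g \<theta> (S x))"
          by (simp add: k_def ennreal_times_divide mult.commute[of "G _"] ennreal_mult_divide_eq)
        moreover have "ennreal (h x * g \<theta> (S x)) = ennreal (h x) * ennreal (g \<theta> (S x))"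
          using elim(3) h_nn g_nn[OF \<theta> S_space] by (simp add: ennreal_mult)
        ultimately show ?thesis
          by (simp add: m_def mult.assoc)
      qed
    qed
    then show "P \<theta> = density M (\<lambda>x. ennreal (g \<theta> (S x)) / G (S x))"
      unfolding P[OF \<theta>] M_density k_def by (subst density_density_eq) (auto intro!: density_cong)
  qed
  then show ?R using M ac_M sets_M by blast
next
  assume ?R
  then obtain M where M: "prob_space M" and sets_M [measurable_cong, simp]: "sets M = sets \<mu>"
    and ac_M: "absolutely_continuous \<mu> M"
    and "\<forall>\<theta>\<in>T. \<exists>k\<in>borel_measurable \<S>. P \<theta> = density M (\<lambda>x. k (S x))" by blast
  then obtain k where k: "\<And>\<theta>. \<theta> \<in> T \<Longrightarrow> k \<theta> \<in> borel_measurable \<S>"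
    and P: "\<And>\<theta>. \<theta> \<in> T \<Longrightarrow> P \<theta> = density M (\<lambda>x. k \<theta> (S x))" by metis
  interpret \<mu>: sigma_finite_measure \<mu> by fact
  interpret M: prob_space M by fact
  obtain h where h [measurable]: "h \<in> borel_measurable \<mu>"
    and h_eq: "AE x in \<mu>. RN_deriv \<mu> M x = ennreal (h x)" and h_nn: "\<And>x. 0 \<le> h x"
    using \<mu>.real_RN_deriv[OF M.finite_measure_axioms ac_M sets_M] by metis
  have M_h: "M = density \<mu> (\<lambda>x. ennreal (h x))"
    using \<mu>.density_RN_deriv[OF ac_M sets_M] density_cong[OF _ _ h_eq] by simp
  show ?L
  proof (rule exI[of _ h], rule exI[of _ "\<lambda>\<theta> s. enn2real (k \<theta> s)"], intro conjI ballI)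
    fix \<theta> assume \<theta>: "\<theta> \<in> T"
    have [measurable]: "k \<theta> \<in> borel_measurable \<S>" using k[OF \<theta>] .
    show "(\<lambda>s. enn2real (k \<theta> s)) \<in> borel_measurable \<S>" by measurable
    have "(\<integral>\<^sup>+ x. k \<theta> (S x) \<partial>M) = emeasure (P \<theta>) (space (P \<theta>))"
      unfolding P[OF \<theta>] using sets.top[of M]
      by (subst emeasure_density) (auto intro!: nn_integral_cong)
    then have "(\<integral>\<^sup>+ x. k \<theta> (S x) \<partial>M) \<noteq> \<infinity>"
      using prob_space.emeasure_space_1[OF prob[OF \<theta>]] by simp
    then have "AE x in M. k \<theta> (S x) \<noteq> \<infinity>"
      by (intro nn_integral_PInf_AE) auto
    then have "AE x in M. k \<theta> (S x) = ennreal (enn2real (k \<theta> (S x)))"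
      by eventually_elim (simp add: less_top)
    then have "P \<theta> = density M (\<lambda>x. ennreal (enn2real (k \<theta> (S x))))"
      unfolding P[OF \<theta>] by (intro density_cong) auto
    also have "\<dots> = density \<mu> (\<lambda>x. ennreal (h x * enn2real (k \<theta> (S x))))"
      unfolding M_h by (subst density_density_eq) (auto simp: ennreal_mult h_nn)
    finally show "P \<theta> = density \<mu> (\<lambda>x. ennreal (h x * enn2real (k \<theta> (S x))))" .
  qed (auto simp: h_nn)
qed

section \<open>Equivalence of factorization and sufficiency\<close>

theorem theorem4p2:
  fixes \<X> :: "'x measure" and \<S> :: "'s measure" and \<Theta> :: "'t measure"
    and \<mu> :: "'x measure" and S :: "'x \<Rightarrow> 's" and P :: "'t \<Rightarrow> 'x measure"
  assumes "standard_measurable_space \<X>"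
    and "space \<X> = {} \<Longrightarrow> space \<S> = {}"
    and "sets \<mu> = sets \<X>" and "sigma_finite_measure \<mu>"
    and "S \<in> \<X> \<rightarrow>\<^sub>M \<S>"
    and "markov_kernel \<Theta> \<X> P"
    and "\<And>\<theta>. \<theta> \<in> space \<Theta> \<Longrightarrow> absolutely_continuous \<mu> (P \<theta>)"
  shows "(\<exists>(h :: 'x \<Rightarrow> real) (g :: 't \<Rightarrow> 's \<Rightarrow> real).
            h \<in> borel_measurable \<X> \<and> (\<forall>x\<in>space \<X>. 0 \<le> h x) \<and>
            (\<forall>\<theta>\<in>space \<Theta>. g \<theta> \<in> borel_measurable \<S> \<and> (\<forall>s\<in>space \<S>. 0 \<le> g \<theta> s) \<and>
               P \<theta> = density \<mu> (\<lambda>x. ennreal (h x * g \<theta> (S x)))))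
         \<longleftrightarrow> sufficient_statistic \<X> \<Theta> \<S> P S"
proof (cases "space \<Theta> = {}")
  case True
  \<comment> \<open>both statements impose no condition on the model, but sufficiency still asks for a kernel to exist\<close>
  have "\<exists>Q. Q \<in> \<S> \<rightarrow>\<^sub>M prob_algebra \<X>"
  proof (cases "space \<X> = {}")
    case True
    then show ?thesis using assms(2) by (auto simp: measurable_def)
  next
    case False
    then obtain x where "x \<in> space \<X>" by auto
    then have "(\<lambda>_. return \<X> x) \<in> \<S> \<rightarrow>\<^sub>M prob_algebra \<X>"
      by (intro measurable_const) (simp add: space_prob_algebra prob_space_return)
    then show ?thesis by blast
  qed
  with True show ?thesis
    unfolding sufficient_statistic_iff_conditional_distribution[OF assms(5,6)]
    by (auto intro!: exI[of _ "\<lambda>_. 0"])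
next
  case False
  have prob_P: "prob_space (P \<theta>)" and sets_P: "sets (P \<theta>) = sets \<X>" if "\<theta> \<in> space \<Theta>" for \<theta>
    using assms(6) that by (auto simp: markov_kernel_iff)
  have space_\<mu>: "space \<mu> = space \<X>" using assms(3) by (rule sets_eq_imp_space_eq)
  have meas_\<mu>: "measurable \<mu> N = measurable \<X> N" for N :: "real measure"
    using assms(3) by (rule measurable_cong_sets) simp
  have sets_P\<mu>: "sets (P \<theta>) = sets \<mu>" if "\<theta> \<in> space \<Theta>" for \<theta>
    using sets_P[OF that] assms(3) by simp
  have S_\<mu>: "S \<in> \<mu> \<rightarrow>\<^sub>M \<S>" using assms(5) by (simp add: measurable_cong_sets[OF assms(3) refl])
  have "(\<exists>M. prob_space M \<and> sets M = sets \<mu> \<and> absolutely_continuous \<mu> M \<and>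
          (\<forall>\<theta>\<in>space \<Theta>. \<exists>k\<in>borel_measurable \<S>. P \<theta> = density M (\<lambda>x. k (S x))))
        \<longleftrightarrow> (\<exists>Q. Q \<in> \<S> \<rightarrow>\<^sub>M prob_algebra \<X> \<and>
          (\<forall>\<theta>\<in>space \<Theta>. is_conditional_distribution \<X> \<S> S (P \<theta>) Q))"
    (is "?dens \<longleftrightarrow> ?cond")
  proof
    assume ?dens
    then obtain M where M: "prob_space M" "sets M = sets \<X>"
      and dens: "\<And>\<theta>. \<theta> \<in> space \<Theta> \<Longrightarrow> \<exists>k\<in>borel_measurable \<S>. P \<theta> = density M (\<lambda>x. k (S x))"
      using assms(3) by auto
    obtain Q where Q: "Q \<in> \<S> \<rightarrow>\<^sub>M prob_algebra \<X>" "is_conditional_distribution \<X> \<S> S M Q"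
      using regular_conditional_distribution_standard[OF assms(1) M assms(5)] .
    have "is_conditional_distribution \<X> \<S> S (P \<theta>) Q" if "\<theta> \<in> space \<Theta>" for \<theta>
      using dens[OF that] is_conditional_distribution_density[OF M(2) assms(5) Q] by auto
    with Q show ?cond by blast
  next
    assume ?cond
    then obtain Q where Q [measurable]: "Q \<in> \<S> \<rightarrow>\<^sub>M prob_algebra \<X>"
      and cond: "\<And>\<theta>. \<theta> \<in> space \<Theta> \<Longrightarrow> is_conditional_distribution \<X> \<S> S (P \<theta>) Q" by blast
    obtain M and t :: "nat \<Rightarrow> 't" and w :: "nat \<Rightarrow> ennreal" where
      M: "prob_space M" and sets_M: "sets M = sets \<mu>"
      and ac_M: "absolutely_continuous \<mu> M" and t: "\<And>n. t n \<in> space \<Theta>"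
      and nn_M: "\<And>f. f \<in> borel_measurable \<mu> \<Longrightarrow> (\<integral>\<^sup>+ x. f x \<partial>M) = (\<Sum>n. w n * (\<integral>\<^sup>+ x. f x \<partial>P (t n)))"
      and dom: "\<And>\<theta>. \<theta> \<in> space \<Theta> \<Longrightarrow> absolutely_continuous M (P \<theta>)"
      by (rule dominating_mixture[OF assms(4) False prob_P sets_P\<mu> assms(7)]) (assumption | rule that | blast)+
    have sets_M\<X> [measurable_cong, simp]: "sets M = sets \<X>" using sets_M assms(3) by simp
    note [measurable] = assms(5)
    \<comment> \<open>both sides of the defining identity are linear in the measure, hence the mixture inherits it\<close>
    have cond_M: "is_conditional_distribution \<X> \<S> S M Q"
      unfolding is_conditional_distribution_def
    proof (intro ballI)
      fix A C assume A [measurable]: "A \<in> sets \<X>" and C [measurable]: "C \<in> sets \<S>"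
      have [measurable]: "(\<lambda>s. emeasure (Q s) A) \<in> borel_measurable \<S>"
        by (rule measurable_emeasure_kernel[OF measurable_prob_algebraD[OF Q] A])
      have AC: "A \<inter> S -` C = A \<inter> (S -` C \<inter> space \<X>)"
        using sets.sets_into_space[OF A] by auto
      have AC_sets [measurable]: "A \<inter> S -` C \<in> sets \<X>" unfolding AC by measurable
      have [measurable_cong, simp]: "sets (P (t n)) = sets \<X>" for n using sets_P t by simp
      have "emeasure M (A \<inter> S -` C) = (\<Sum>n. w n * emeasure (P (t n)) (A \<inter> S -` C))"
        using nn_M[of "indicator (A \<inter> S -` C)"] AC_sets assms(3) by simp
      also have "\<dots> = (\<Sum>n. w n * (\<integral>\<^sup>+ x. emeasure (Q (S x)) A * indicator C (S x) \<partial>P (t n)))"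
        using cond[OF t] A C by (simp add: is_conditional_distribution_def nn_integral_distr)
      also have "\<dots> = (\<integral>\<^sup>+ x. emeasure (Q (S x)) A * indicator C (S x) \<partial>M)"
        by (rule nn_M[symmetric]) (simp add: measurable_cong_sets[OF assms(3) refl])
      also have "\<dots> = (\<integral>\<^sup>+ s\<in>C. emeasure (Q s) A \<partial>distr M \<S> S)"
        by (simp add: nn_integral_distr)
      finally show "emeasure M (A \<inter> S -` C) = (\<integral>\<^sup>+ s\<in>C. emeasure (Q s) A \<partial>distr M \<S> S)" .
    qed
    define k where "k \<theta> = RN_deriv (distr M \<S> S) (distr (P \<theta>) \<S> S)" for \<theta>
    have "k \<theta> \<in> borel_measurable \<S>" for \<theta>
      using borel_measurable_RN_deriv[of "distr M \<S> S" "distr (P \<theta>) \<S> S"] by (simp add: k_def)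
    moreover have "P \<theta> = density M (\<lambda>x. k \<theta> (S x))" if "\<theta> \<in> space \<Theta>" for \<theta>
      unfolding k_def
      by (rule density_if_common_conditional_distribution
            [OF M sets_M\<X> sets_P[OF that] assms(5) Q cond_M cond[OF that] dom[OF that]])
    ultimately show ?dens using M sets_M ac_M by blast
  qed
  with factorization_iff_dominating_density[OF assms(4) False prob_P sets_P\<mu> assms(7) S_\<mu>]
  show ?thesis
    unfolding sufficient_statistic_iff_conditional_distribution[OF assms(5,6)] meas_\<mu> space_\<mu>
    by (rule trans)
qed

end
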